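(* Let $M=([n],\mathcal{B})$ be a delta-matroid and let $G_M$ be its basis graph. Then any two walks in $G_M$ with the same end-points (the same first vertex and the same last vertex) are combinatorially homotopic.
   Context: Let $[n]=\{1,\dots,n\}$ and let $\triangle$ denote symmetric difference of sets. A delta-matroid on $[n]$ is a pair $([n],\mathcal{B})$ with $\mathcal{B}$ a non-empty collection of subsets of $[n]$ (called bases) such that for all $B,B'\in\mathcal{B}$ and $e\in B\triangle B'$ there is $f\in B\triangle B'$ (possibly $f=e$) with $B\triangle\{e,f\}\in\mathcal{B}$. The basis graph $G_M$ of a delta-matroid $M=([n],\mathcal{B})$ is the graph with vertex set $\mathcal{B}$ in which $B$ and $B'$ are adjacent if and only if $|B\triangle B'|=1$ or $2$. Graphs are undirected and simple. A walk in a graph is a sequence of vertices $v_0v_1\cdots v_l$ in which consecutive vertices are adjacent. The elementary transformations relating two walks $W_1,W_2$ are: (i) deletion: $W_1=v_0\cdots v_{k-1}v_kv_{k+1}\cdots v_l$ and $W_2=v_0\cdots v_{k-1}v_{k+2}\cdots v_l$ for some $k$ with $v_{k-1}=v_{k+1}$; (ii) shortcut: $W_1=v_0\cdots v_{k-1}v_kv_{k+1}\cdots v_l$ and $W_2=v_0\cdots v_{k-1}v_{k+1}\cdots v_l$ for some $k$ with $v_{k-1}\neq v_{k+1}$ (both are walks, so $v_{k-1}$ and $v_{k+1}$ are adjacent); (iii) 2-switch: $W_1=v_0\cdots v_{k-1}v_kv_{k+1}\cdots v_l$ and $W_2=v_0\cdots v_{k-1}v_k'v_{k+1}\cdots v_l$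 for some $k$, where $v_{k-1}$ and $v_{k+1}$ are at distance exactly $2$ in the graph. Two walks are combinatorially homotopic if one can be obtained from the other by a finite sequence of elementary transformations, each used in either direction. *)

theory Defs
  imports "Graph_Theory.Pair_Digraph" "Graph_Theory.Vertex_Walk" "Graph_Theory.Shortest_Path"
begin

definition delta_matroid :: "nat \<Rightarrow> nat set set \<Rightarrow> bool" where
  "delta_matroid n \<B> \<longleftrightarrow>
     \<B> \<noteq> {} \<and> \<B> \<subseteq> Pow {1..n} \<and>
     (\<forall>B\<in>\<B>. \<forall>B'\<in>\<B>. \<forall>e\<in>sym_diff B B'. \<exists>f\<in>sym_diff B B'. sym_diff B {e, f} \<in> \<B>)"

text \<open>Undirected simple graphs are symmetric, loop-free pair digraphs.\<close>

definition basis_graph :: "'a set set \<Rightarrow> 'a set pair_pre_digraph" where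
  "basis_graph \<B> =
     \<lparr> pverts = \<B>,
       parcs = {(B, B'). B \<in> \<B> \<and> B' \<in> \<B> \<and>
                  (card (sym_diff B B') = 1 \<or> card (sym_diff B B') = 2)} \<rparr>"

definition graph_dist :: "('a, 'b) pre_digraph \<Rightarrow> 'a \<Rightarrow> 'a \<Rightarrow> ereal" where
  "graph_dist G u v = wf_digraph.\<mu> G (\<lambda>_. 1) u v"

text \<open>In each rule \<open>u\<close>, \<open>v\<close>, \<open>w\<close> are the consecutive vertices with indices
  \<open>k - 1\<close>, \<open>k\<close>, \<open>k + 1\<close> of the first walk.\<close>

inductive elementary_transformation ::
  "('a, 'b) pre_digraph \<Rightarrow> 'a vwalk \<Rightarrow> 'a vwalk \<Rightarrow> bool" for G where
  deletion:
    "vwalk (p @ [u, v, w] @ q) G \<Longrightarrow> vwalk (p @ [u] @ q) G \<Longrightarrow> u = w \<Longrightarrow>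
     elementary_transformation G (p @ [u, v, w] @ q) (p @ [u] @ q)"
| shortcut:
    "vwalk (p @ [u, v, w] @ q) G \<Longrightarrow> vwalk (p @ [u, w] @ q) G \<Longrightarrow> u \<noteq> w \<Longrightarrow>
     elementary_transformation G (p @ [u, v, w] @ q) (p @ [u, w] @ q)"
| two_switch:
    "vwalk (p @ [u, v, w] @ q) G \<Longrightarrow> vwalk (p @ [u, v', w] @ q) G \<Longrightarrow> graph_dist G u w = 2 \<Longrightarrow>
     elementary_transformation G (p @ [u, v, w] @ q) (p @ [u, v', w] @ q)"

definition combinatorially_homotopic ::
  "('a, 'b) pre_digraph \<Rightarrow> 'a vwalk \<Rightarrow> 'a vwalk \<Rightarrow> bool" where
  "combinatorially_homotopic G = equivclp (elementary_transformation G)"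

lemma pair_bidirected_digraph_basis_graph: "pair_bidirected_digraph (basis_graph \<B>)"
  by unfold_locales
     (auto simp: basis_graph_def symmetric_def Un_commute intro!: symI)

lemma graph_dist_le_length:
  assumes "wf_digraph G" "pre_digraph.awalk G u p v"
  shows "graph_dist G u v \<le> ereal (real (length p))"
proof -
  interpret wf_digraph G by fact
  have "awalk_cost (\<lambda>_. 1) p = real (length p)"
    by (induction p) auto
  with min_cost_le_walk_cost[OF assms(2), of "\<lambda>_. 1"] show ?thesis
    by (simp add: graph_dist_def)
qed

lemma graph_dist_eq_2_iff:
  assumes "wf_digraph G" "u \<in> verts G"
  shows "graph_dist G u w = 2 \<longleftrightarrow>
    u \<noteq> w \<and> \<not> u \<rightarrow>\<^bsub>G\<^esub> w \<and> (\<exists>v. u \<rightarrow>\<^bsub>G\<^esub> v \<and> v \<rightarrow>\<^bsub>G\<^esub> w)"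
    (is "?L \<longleftrightarrow> ?R")
proof -
  interpret wf_digraph G by fact
  have len: "awalk_cost (\<lambda>_. 1) p = real (length p)" for p
    by (induction p) auto
  have dist: "graph_dist G u w = (INF p\<in>{p. awalk u p w}. ereal (real (length p)))"
    by (simp add: graph_dist_def \<mu>_def len)
  have one: "awalk u [a] w" if "a \<in> arcs G" "tail G a = u" "head G a = w" for a
    using that by (auto simp: awalk_def)
  have lower: "n \<le> length p" if "awalk u p w" "n = 2" "u \<noteq> w" "\<not> u \<rightarrow>\<^bsub>G\<^esub> w" for n p
  proof (cases p)
    case Nil
    with that show ?thesis by (auto simp: awalk_def)
  next
    case (Cons a q)
    show ?thesis
    proof (cases q)
      case Nil
      with Cons that show ?thesis by (auto simp: awalk_def arcs_ends_conv)
    qed (use Cons that in auto)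
  qed
  show ?thesis
  proof
    assume L: ?L
    have "u \<noteq> w"
    proof
      assume "u = w"
      then have "awalk u [] w" using assms(2) by (auto simp: awalk_def)
      from graph_dist_le_length[OF assms(1) this] L show False by simp
    qed
    moreover have "\<not> u \<rightarrow>\<^bsub>G\<^esub> w"
    proof
      assume "u \<rightarrow>\<^bsub>G\<^esub> w"
      then obtain a where "awalk u [a] w" using one by (auto simp: arcs_ends_conv)
      from graph_dist_le_length[OF assms(1) this] L show False by simp
    qed
    moreover have "\<exists>v. u \<rightarrow>\<^bsub>G\<^esub> v \<and> v \<rightarrow>\<^bsub>G\<^esub> w"
    proof -
      have "graph_dist G u w < 3" using L by simp
      then obtain p where p: "awalk u p w" "length p < 3"
        unfolding dist INF_less_iff by auto
      with lower[OF p(1) refl] calculation have "length p = 2" by auto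
      then obtain a b where "p = [a, b]" by (auto simp: length_Suc_conv numeral_2_eq_2)
      with p show ?thesis by (auto simp: awalk_def arcs_ends_conv)
    qed
    ultimately show ?R by blast
  next
    assume R: ?R
    then obtain a b where "awalk u [a, b] w"
      by (fastforce simp: arcs_ends_conv awalk_def)
    from graph_dist_le_length[OF assms(1) this] have "graph_dist G u w \<le> 2" by simp
    moreover have "2 \<le> graph_dist G u w"
      unfolding dist using R lower by (auto intro!: INF_greatest)
    ultimately show ?L by (rule antisym)
  qed
qed

end

theory Submission
  imports Defs "HOL-Library.Multiset"
begin

text \<open>Fix a basis \<open>b\<close> and let \<open>d v = |v \<triangle> b|\<close>. If \<open>v\<close> maximises \<open>d\<close> on a closed walk at \<open>b\<close> and
  has neighbours \<open>u\<close> and \<open>w\<close> there, then \<open>u v w\<close> can be rerouted from \<open>u\<close> to \<open>w\<close> through vertices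
  with smaller \<open>d\<close>: by the exchange axiom, any two neighbours \<open>v \<triangle> {a, a'}\<close> and \<open>v \<triangle> {c, c'}\<close> of
  \<open>v\<close> that are closer to \<open>b\<close> are linked by triangles and 4-cycles through such vertices. Replacing
  \<open>v\<close> by vertices of smaller \<open>d\<close> terminates in the multiset order, so every closed walk is
  contractible.\<close>

section \<open>Homotopy of walks in a digraph\<close>

text \<open>This form is preferred because \<open>successively\<close> has an append rule, so
  splitting and gluing walks becomes simplification.\<close>

lemma vwalk_iff_successively:
  "vwalk W G \<longleftrightarrow> W \<noteq> [] \<and> set W \<subseteq> verts G \<and> successively (\<lambda>x y. x \<rightarrow>\<^bsub>G\<^esub> y) W"
proof -
  have "set (vwalk_arcs W) \<subseteq> arcs_ends G \<longleftrightarrow> successively (\<lambda>x y. x \<rightarrow>\<^bsub>G\<^esub> y) W"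
    by (induction W rule: vwalk_arcs.induct) auto
  then show ?thesis by (auto simp: vwalk_def)
qed

lemma vwalk_replace_infix:
  assumes "vwalk (p @ P @ q) G" "vwalk Q G" "P \<noteq> []" "hd P = hd Q" "last P = last Q"
  shows "vwalk (p @ Q @ q) G"
  using assms by (auto simp: vwalk_iff_successively successively_append_iff)

lemma elementary_transformation_vwalk:
  assumes "elementary_transformation G P Q"
  shows "vwalk P G" "vwalk Q G" "hd P = hd Q" "last P = last Q"
  using assms by (induction rule: elementary_transformation.induct) (auto simp: hd_append)

lemma elementary_transformation_append:
  assumes "elementary_transformation G P Q" "vwalk (p @ P @ q) G"
  shows "elementary_transformation G (p @ P @ q) (p @ Q @ q)"
proof -
  have "P \<noteq> []" using elementary_transformation_vwalk(1)[OF assms(1)] by (auto simp: vwalk_def)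
  then have "vwalk (p @ Q @ q) G"
    using vwalk_replace_infix[OF assms(2)] elementary_transformation_vwalk[OF assms(1)] by blast
  with assms show ?thesis
  proof (induction rule: elementary_transformation.induct)
    case (deletion p' u v w q')
    then show ?case
      using elementary_transformation.deletion[of "p @ p'" u v w "q' @ q" G] by simp
  next
    case (shortcut p' u v w q')
    then show ?case
      using elementary_transformation.shortcut[of "p @ p'" u v w "q' @ q" G] by simp
  next
    case (two_switch p' u v w q' v')
    then show ?case
      using elementary_transformation.two_switch[of "p @ p'" u v w "q' @ q" G v'] by simp
  qed
qed

lemma combinatorially_homotopic_refl: "combinatorially_homotopic G P P"
  by (simp add: combinatorially_homotopic_def equivclp_def)

lemma combinatorially_homotopic_sym:
  "combinatorially_homotopic G P Q \<Longrightarrow> combinatorially_homotopic G Q P"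
  by (simp add: combinatorially_homotopic_def equivclp_sym)

lemma combinatorially_homotopic_trans [trans]:
  "combinatorially_homotopic G P Q \<Longrightarrow> combinatorially_homotopic G Q R \<Longrightarrow>
   combinatorially_homotopic G P R"
  unfolding combinatorially_homotopic_def by (rule transpD[OF transp_equivclp])

lemma elementary_transformation_homotopic:
  "elementary_transformation G P Q \<Longrightarrow> combinatorially_homotopic G P Q"
  by (auto simp: combinatorially_homotopic_def equivclp_def symclp_def intro: r_into_rtranclp)

lemma combinatorially_homotopic_vwalk:
  assumes "combinatorially_homotopic G P Q" "vwalk P G"
  shows "vwalk Q G" "hd Q = hd P" "last Q = last P"
proof -
  from assms(1) have "vwalk Q G \<and> hd Q = hd P \<and> last Q = last P"
    unfolding combinatorially_homotopic_def
    by (induction rule: equivclp_induct) (use assms(2) elementary_transformation_vwalk in metis)+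
  then show "vwalk Q G" "hd Q = hd P" "last Q = last P" by auto
qed

text \<open>Each walk in the chain from \<open>P\<close> to \<open>Q\<close> keeps the end vertices
  of \<open>P\<close>, so it can stand between \<open>p\<close> and \<open>q\<close>, and each
  elementary transformation lifts to the longer walk.\<close>

lemma combinatorially_homotopic_append:
  assumes "combinatorially_homotopic G P Q" "vwalk P G" "vwalk (p @ P @ q) G"
  shows "combinatorially_homotopic G (p @ P @ q) (p @ Q @ q)"
  using assms(1) unfolding combinatorially_homotopic_def
proof (induction rule: equivclp_induct)
  case base
  then show ?case by (simp add: equivclp_def)
next
  case (step Q R)
  from step(1) have "combinatorially_homotopic G P Q" by (simp add: combinatorially_homotopic_def)
  note Q = combinatorially_homotopic_vwalk[OF this assms(2)]
  from step(2) have "elementary_transformation G (p @ Q @ q) (p @ R @ q) \<or>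
    elementary_transformation G (p @ R @ q) (p @ Q @ q)"
  proof
    assume "elementary_transformation G Q R"
    moreover have "vwalk (p @ Q @ q) G"
      using vwalk_replace_infix[OF assms(3)] Q assms(2) by (auto simp: vwalk_def)
    ultimately show ?thesis using elementary_transformation_append by blast
  next
    assume R: "elementary_transformation G R Q"
    then have "vwalk (p @ R @ q) G"
      using vwalk_replace_infix[OF assms(3)] Q assms(2) elementary_transformation_vwalk[OF R]
      by (auto simp: vwalk_def)
    with R show ?thesis using elementary_transformation_append by blast
  qed
  then have "combinatorially_homotopic G (p @ Q @ q) (p @ R @ q)"
    using elementary_transformation_homotopic combinatorially_homotopic_sym by metis
  with step(3) show ?case
    using combinatorially_homotopic_trans by (simp add: combinatorially_homotopic_def) blast
qed

section \<open>Contracting closed walks by a height function\<close>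

text \<open>The case \<open>xs = []\<close> is needed because \<open>[u, u]\<close> is not a walk.\<close>

definition bypass :: "('a, 'b) pre_digraph \<Rightarrow> ('a \<Rightarrow> nat) \<Rightarrow> 'a \<Rightarrow> 'a \<Rightarrow> 'a \<Rightarrow> bool" where
  "bypass G d v u w \<longleftrightarrow>
     (\<exists>xs. (xs = [] \<and> u = w \<or> (\<exists>ys. xs = ys @ [w] \<and> (\<forall>y\<in>set ys. d y < d v))) \<and>
           combinatorially_homotopic G [u, v, w] (u # xs))"

lemma bypass_adjacent:
  assumes "vwalk [u, v, w] G" "u = w \<or> u \<rightarrow>\<^bsub>G\<^esub> w"
  shows "bypass G d v u w"
proof (cases "u = w")
  case True
  have "elementary_transformation G ([] @ [u, v, w] @ []) ([] @ [u] @ [])"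
    by (rule elementary_transformation.deletion)
      (use assms True in \<open>auto simp: vwalk_iff_successively\<close>)
  with True show ?thesis
    unfolding bypass_def by (intro exI[of _ "[]"]) (auto dest: elementary_transformation_homotopic)
next
  case False
  have "elementary_transformation G ([] @ [u, v, w] @ []) ([] @ [u, w] @ [])"
    by (rule elementary_transformation.shortcut)
      (use assms False in \<open>auto simp: vwalk_iff_successively\<close>)
  with False show ?thesis
    unfolding bypass_def by (intro exI[of _ "[w]"]) (auto dest: elementary_transformation_homotopic)
qed

text \<open>If \<open>u\<close> and \<open>w\<close> are distinct and not adjacent, the path through
  \<open>v\<close> puts them at distance exactly 2, so a 2-switch replaces \<open>v\<close> by
  \<open>x\<close>; otherwise a deletion or a shortcut suffices.\<close>

lemma bypass_square:
  assumes "wf_digraph G" "vwalk [u, v, w] G" "vwalk [u, x, w] G" "d x < d v"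
  shows "bypass G d v u w"
proof (cases "u = w \<or> u \<rightarrow>\<^bsub>G\<^esub> w")
  case True
  then show ?thesis using bypass_adjacent[OF assms(2)] by blast
next
  case False
  have "graph_dist G u w = 2"
    using graph_dist_eq_2_iff[OF assms(1), of u w] assms(2) False
    by (auto simp: vwalk_iff_successively)
  then have "elementary_transformation G ([] @ [u, v, w] @ []) ([] @ [u, x, w] @ [])"
    by (intro elementary_transformation.two_switch) (use assms in auto)
  with assms(4) show ?thesis
    unfolding bypass_def
    by (intro exI[of _ "[x, w]"]) (auto dest: elementary_transformation_homotopic)
qed

text \<open>A reversed deletion inserts the detour through \<open>x\<close>, turning
  \<open>[u, v, w]\<close> into \<open>[u, v, x, v, w]\<close>; then each of the two passages
  through \<open>v\<close> is rerouted separately. The junction \<open>x\<close> becomes an inner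
  vertex of the result, hence the bound on \<open>d x\<close>.\<close>

lemma bypass_trans:
  assumes "bypass G d v u x" "bypass G d v x w" "d x < d v"
    and "vwalk [u, v, x, v, w] G"
  shows "bypass G d v u w"
proof -
  obtain xs where xs: "xs = [] \<and> u = x \<or> (\<exists>ys. xs = ys @ [x] \<and> (\<forall>y\<in>set ys. d y < d v))"
    "combinatorially_homotopic G [u, v, x] (u # xs)"
    using assms(1) unfolding bypass_def by blast
  obtain zs where zs: "zs = [] \<and> x = w \<or> (\<exists>ys. zs = ys @ [w] \<and> (\<forall>y\<in>set ys. d y < d v))"
    "combinatorially_homotopic G [x, v, w] (x # zs)"
    using assms(2) unfolding bypass_def by blast
  have walks: "vwalk [u, v, x] G" "vwalk [x, v, w] G" "vwalk [u, v, w] G"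
    using assms(4) by (auto simp: vwalk_iff_successively)
  have last: "last (u # xs) = x" using xs(1) by auto
  have "elementary_transformation G ([u] @ [v, x, v] @ [w]) ([u] @ [v] @ [w])"
    by (rule elementary_transformation.deletion) (use assms(4) walks in auto)
  then have "combinatorially_homotopic G [u, v, w] [u, v, x, v, w]"
    using elementary_transformation_homotopic combinatorially_homotopic_sym by fastforce
  also have h: "combinatorially_homotopic G [u, v, x, v, w] ((u # xs) @ [v, w])"
    using combinatorially_homotopic_append[OF xs(2) walks(1), of "[]" "[v, w]"] assms(4) by simp
  \<comment> \<open>The first detour ends in \<open>x\<close>; splitting off this last vertex
    exposes the infix \<open>[x, v, w]\<close> for the second detour.\<close>
  also have eq: "(u # xs) @ [v, w] = butlast (u # xs) @ [x, v, w] @ []"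
    using last by (metis append.assoc append_Cons append_Nil append_Nil2
      append_butlast_last_id list.distinct(1))
  also have "combinatorially_homotopic G \<dots> (butlast (u # xs) @ (x # zs) @ [])"
    using combinatorially_homotopic_append[OF zs(2) walks(2)]
      combinatorially_homotopic_vwalk(1)[OF h assms(4)] unfolding eq by blast
  also have "butlast (u # xs) @ (x # zs) @ [] = u # xs @ zs"
    using last by (metis append.assoc append_Cons append_Nil append_Nil2
      append_butlast_last_id list.distinct(1))
  finally have "combinatorially_homotopic G [u, v, w] (u # xs @ zs)" .
  moreover have "xs @ zs = [] \<and> u = w \<or> (\<exists>ys. xs @ zs = ys @ [w] \<and> (\<forall>y\<in>set ys. d y < d v))"
    using xs(1) zs(1) assms(3) by auto
  ultimately show ?thesis unfolding bypass_def by blast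
qed

text \<open>Well-founded induction on the multiset of heights: a bypass around a highest vertex
  removes one occurrence of the maximal height and adds only smaller ones.\<close>

lemma closed_walk_contractible:
  fixes d :: "'a \<Rightarrow> nat"
  assumes bypass: "\<And>v u w. vwalk [u, v, w] G \<Longrightarrow> 0 < d v \<Longrightarrow> d u \<le> d v \<Longrightarrow> d w \<le> d v \<Longrightarrow>
      bypass G d v u w"
    and zero: "\<And>v. v \<in> verts G \<Longrightarrow> d v = 0 \<longleftrightarrow> v = b"
    and loopfree: "\<And>v. \<not> v \<rightarrow>\<^bsub>G\<^esub> v"
    and "vwalk W G" "hd W = b" "last W = b"
  shows "combinatorially_homotopic G W [b]"
  using assms(4-)
proof (induction "image_mset d (mset W)" arbitrary: W rule: wf_induct_rule[OF wf_mult[OF wf_less_than]])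
  case 1
  note W = 1(2-4)
  show ?case
  proof (cases "\<forall>x\<in>set W. d x = 0")
    case True
    then have all: "\<forall>x\<in>set W. x = b" using zero W(1) by (auto simp: vwalk_def)
    show ?thesis
    proof (cases W)
      case (Cons x xs)
      with all W loopfree have "W = [b]"
        by (cases xs) (auto simp: vwalk_iff_successively)
      then show ?thesis by (simp add: combinatorially_homotopic_refl)
    qed (use W in \<open>simp add: vwalk_def\<close>)
  next
    case False
    define k where "k = Max (d ` set W)"
    have le: "d x \<le> k" if "x \<in> set W" for x using that by (simp add: k_def)
    have "k \<in> d ` set W" using W(1) by (auto simp: k_def vwalk_def intro!: Max_in)
    then obtain v where v: "v \<in> set W" "d v = k" by auto
    have "0 < d v" using False le v(2) by (metis bot_nat_0.not_eq_extremum le_zero_eq)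
    have "b \<in> verts G" using W by (auto simp: vwalk_def)
    then have "v \<noteq> b" using zero \<open>0 < d v\<close> by (metis less_irrefl)
    obtain p' q' where pq': "W = p' @ v # q'" using v(1) by (auto simp: in_set_conv_decomp)
    \<comment> \<open>The walk begins and ends at \<open>b\<close>, so \<open>v\<close> is an inner
      vertex and has a neighbour on either side.\<close>
    have "p' \<noteq> []" "q' \<noteq> []" using pq' W \<open>v \<noteq> b\<close> by auto
    then obtain p u w q where "p' = p @ [u]" "q' = w # q"
      by (metis append_butlast_last_id neq_Nil_conv)
    with pq' have Weq: "W = p @ [u, v, w] @ q" by simp
    have walk: "vwalk [u, v, w] G"
      using W(1) by (auto simp: Weq vwalk_iff_successively successively_append_iff)
    have "d u \<le> d v" "d w \<le> d v" using le v(2) by (auto simp: Weq)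
    from bypass[OF walk \<open>0 < d v\<close> this] obtain xs where
      xs: "xs = [] \<and> u = w \<or> (\<exists>ys. xs = ys @ [w] \<and> (\<forall>y\<in>set ys. d y < d v))"
      "combinatorially_homotopic G [u, v, w] (u # xs)"
      unfolding bypass_def by blast
    have hom: "combinatorially_homotopic G W (p @ (u # xs) @ q)"
      using combinatorially_homotopic_append[OF xs(2) walk] W(1) by (simp add: Weq)
    let ?I = "image_mset d (mset (p @ [u] @ q))"
    from xs(1) have "(image_mset d (mset (p @ (u # xs) @ q)), image_mset d (mset W)) \<in> mult less_than"
    proof
      assume "xs = [] \<and> u = w"
      \<comment> \<open>Here \<open>u\<close> and \<open>w\<close> coincide and survive as a single
        vertex, so two heights disappear and none is added.\<close>
      then show ?thesis
        using one_step_implies_mult[of "{#d v, d w#}" "{#}" less_than ?I]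
        by (simp add: Weq add_mset_commute)
    next
      assume "\<exists>ys. xs = ys @ [w] \<and> (\<forall>y\<in>set ys. d y < d v)"
      then obtain ys where "xs = ys @ [w]" "\<forall>y\<in>set ys. d y < d v" by blast
      then show ?thesis
        using one_step_implies_mult[of "{#d v#}" "image_mset d (mset ys)" less_than "?I + {#d w#}"]
        by (simp add: Weq ac_simps add_mset_commute)
    qed
    from 1(1)[OF this] combinatorially_homotopic_vwalk[OF hom W(1)] W
    have "combinatorially_homotopic G (p @ (u # xs) @ q) [b]" by simp
    with hom show ?thesis by (rule combinatorially_homotopic_trans)
  qed
qed

text \<open>Induction on \<open>W'\<close> from its end. If \<open>W'\<close> is a single vertex,
  \<open>W\<close> is closed. Otherwise \<open>W\<close> is extended back to the last but one vertex
  \<open>y\<close> of \<open>W'\<close>, the extension is compared with \<open>V\<close> by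
  induction, and the final step to \<open>z\<close> is appended to both.\<close>

lemma homotopic_if_closed_walks_contractible:
  assumes contract: "\<And>W. vwalk W G \<Longrightarrow> hd W = b \<Longrightarrow> last W = b \<Longrightarrow> combinatorially_homotopic G W [b]"
    and sym: "\<And>x y. x \<rightarrow>\<^bsub>G\<^esub> y \<Longrightarrow> y \<rightarrow>\<^bsub>G\<^esub> x"
    and "vwalk W G" "vwalk W' G" "hd W = b" "hd W' = b" "last W = last W'"
  shows "combinatorially_homotopic G W W'"
  using assms(3-)
proof (induction W' arbitrary: W rule: rev_induct)
  case Nil
  then show ?case by (simp add: vwalk_def)
next
  case (snoc z V)
  show ?case
  proof (cases "V = []")
    case True
    then show ?thesis using contract snoc.prems by simp
  next
    case False
    define y where "y = last V"
    have V: "vwalk V G" "y \<rightarrow>\<^bsub>G\<^esub> z" "hd V = b" "y \<in> verts G"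
      using snoc.prems False by (auto simp: vwalk_iff_successively successively_append_iff y_def)
    have W: "W \<noteq> []" "last W = z" using snoc.prems by (auto simp: vwalk_def)
    have walk: "vwalk (W @ [y]) G" "vwalk (W @ [y, z]) G"
      using snoc.prems V sym W
      by (auto simp: vwalk_iff_successively successively_append_iff)
    have Weq: "W = butlast W @ [z]" using W by (metis append_butlast_last_id)
    \<comment> \<open>Read backwards, this deletion adds the spur from \<open>z\<close> to
      \<open>y\<close> and back at the end of \<open>W\<close>.\<close>
    have "elementary_transformation G (butlast W @ [z, y, z] @ []) (butlast W @ [z] @ [])"
      by (rule elementary_transformation.deletion)
        (use walk(2) snoc.prems(1) Weq in \<open>metis append.assoc append_Cons append_Nil append_Nil2\<close>)+
    moreover have "butlast W @ [z, y, z] @ [] = W @ [y, z]" "butlast W @ [z] @ [] = W"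
      by (subst (2) Weq, simp, metis Weq append_Nil2)
    ultimately have "combinatorially_homotopic G W (W @ [y, z])"
      using elementary_transformation_homotopic combinatorially_homotopic_sym by metis
    also have "combinatorially_homotopic G (W @ [y]) V"
      using snoc.IH[OF walk(1) V(1)] V W snoc.prems by (simp add: y_def)
    from combinatorially_homotopic_append[OF this walk(1), of "[]" "[z]"] walk(2)
    have "combinatorially_homotopic G (W @ [y, z]) (V @ [z])" by simp
    finally show ?thesis .
  qed
qed

section \<open>The exchange axiom\<close>

text \<open>Allowing \<open>x = y\<close> covers cardinalities 1 and 2 at once and matches the set
  \<open>{e, f}\<close> in the exchange axiom.\<close>

lemma basis_graph_arc_iff:
  "B \<rightarrow>\<^bsub>with_proj (basis_graph \<B>)\<^esub> B' \<longleftrightarrow> B \<in> \<B> \<and> B' \<in> \<B> \<and> (\<exists>x y. sym_diff B B' = {x, y})"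
proof -
  have "card A = 1 \<or> card A = 2 \<longleftrightarrow> (\<exists>x y. A = {x, y})" for A :: "'a set"
    by (metis card_1_singletonE card_2_iff card_insert_if finite.emptyI insert_absorb2
      is_singletonI is_singleton_altdef numeral_2_eq_2 One_nat_def)
  then show ?thesis by (auto simp: basis_graph_def)
qed

lemma bypass_basis_graph:
  fixes \<B> :: "'a set set" and b :: "'a set"
  defines "d \<equiv> \<lambda>x. card (sym_diff x b)"
  assumes exchange: "\<And>B B' e. B \<in> \<B> \<Longrightarrow> B' \<in> \<B> \<Longrightarrow> e \<in> sym_diff B B' \<Longrightarrow>
      \<exists>f\<in>sym_diff B B'. sym_diff B {e, f} \<in> \<B>"
    and fin: "\<And>B. B \<in> \<B> \<Longrightarrow> finite B"
    and b: "b \<in> \<B>"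
    and walk: "vwalk [u, v, w] (with_proj (basis_graph \<B>))"
    and le: "d u \<le> d v" "d w \<le> d v"
  shows "bypass (with_proj (basis_graph \<B>)) d v u w"
proof -
  note with_proj_simps [simp del]
  let ?G = "with_proj (basis_graph \<B>)"
  interpret pair_bidirected_digraph "basis_graph \<B>" by (rule pair_bidirected_digraph_basis_graph)
  have verts: "verts ?G = \<B>" by (simp add: basis_graph_def with_proj_simps)
  have v: "v \<in> \<B>" using walk verts by (auto simp: vwalk_def)
  define D where "D = sym_diff v b"
  have finD: "finite D" using v b fin by (simp add: D_def)
  \<comment> \<open>Bases are described by their difference from \<open>v\<close>: \<open>S\<close> stands for \<open>v \<triangle> S\<close>, so \<open>v\<close> is \<open>{}\<close> and
    \<open>b\<close> is \<open>D\<close>.\<close>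
  define F where "F S \<longleftrightarrow> sym_diff v S \<in> \<B>" for S
  have sd: "sym_diff (sym_diff v S) (sym_diff v T) = sym_diff S T" for S T by blast
  have F0: "F {}" using v by (simp add: F_def)
  have "sym_diff v D = b" unfolding D_def by blast
  then have FD: "F D" using b by (simp add: F_def)
  have exF: "\<exists>f\<in>sym_diff S T. F (sym_diff S {e, f})" if ST: "F S" "F T" "e \<in> sym_diff S T" for S T e
  proof -
    obtain f where "f \<in> sym_diff S T" "sym_diff (sym_diff v S) {e, f} \<in> \<B>"
      using exchange[of "sym_diff v S" "sym_diff v T" e] ST unfolding F_def sd by blast
    moreover have "sym_diff (sym_diff v S) {e, f} = sym_diff v (sym_diff S {e, f})" by blast
    ultimately show ?thesis unfolding F_def by metis
  qed
  \<comment> \<open>Exchange from \<open>v\<close> towards v \<triangle> S: every element of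
    \<open>S\<close> lies in a set of at most two elements of \<open>S\<close> that leads to a
    basis.\<close>
  have exF0: "\<exists>f\<in>S. F {e, f}" if "F S" "e \<in> S" for S e
    using exF[OF F0 that(1), of e] that(2) by simp
  have lower: "d (sym_diff v S) < d v" if "S \<subseteq> D" "S \<noteq> {}" for S
  proof -
    have "sym_diff (sym_diff v S) b = D - S" using that(1) by (auto simp: D_def)
    moreover have "card (D - S) < card D"
      using that finD by (intro psubset_card_mono) auto
    ultimately show ?thesis by (simp add: d_def D_def)
  qed
  have adj: "sym_diff v S = sym_diff v T \<or> sym_diff v S \<rightarrow>\<^bsub>?G\<^esub> sym_diff v T"
    if "F S" "F T" "sym_diff S T \<subseteq> {x, y}" for S T x y
  proof -
    have "sym_diff S T = {} \<or> (\<exists>x y. sym_diff S T = {x, y})"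
    proof -
      have "A = {} \<or> A = {x, x} \<or> A = {y, y} \<or> A = {x, y}" if "A \<subseteq> {x, y}" for A
        using that by auto
      from this[OF that(3)] show ?thesis by blast
    qed
    then show ?thesis
    proof
      assume "sym_diff S T = {}"
      then have "S = T" by blast
      then show ?thesis by simp
    qed (use that in \<open>simp add: basis_graph_arc_iff F_def sd\<close>)
  qed
  have adj_v: "sym_diff v {a, c} \<rightarrow>\<^bsub>?G\<^esub> v" "v \<rightarrow>\<^bsub>?G\<^esub> sym_diff v {a, c}" "sym_diff v {a, c} \<in> \<B>"
    if "F {a, c}" for a c
  proof -
    have "sym_diff (sym_diff v {a, c}) v = {a, c}" "sym_diff v (sym_diff v {a, c}) = {a, c}" by blast+
    then show "sym_diff v {a, c} \<rightarrow>\<^bsub>?G\<^esub> v" "v \<rightarrow>\<^bsub>?G\<^esub> sym_diff v {a, c}" "sym_diff v {a, c} \<in> \<B>"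
      using that v unfolding basis_graph_arc_iff F_def by metis+
  qed
  \<comment> \<open>Taking both directions makes the relation symmetric without an argument about
    reversing homotopies.\<close>
  define L where "L S T \<longleftrightarrow> bypass ?G d v (sym_diff v S) (sym_diff v T) \<and>
    bypass ?G d v (sym_diff v T) (sym_diff v S)" for S T
  have common: "bypass ?G d v (sym_diff v {a, a'}) (sym_diff v {c, c'})"
    if "F {a, a'}" "F {c, c'}" "F X" "X \<subseteq> D" "X \<noteq> {}"
      "sym_diff {a, a'} X \<subseteq> {x, y}" "sym_diff X {c, c'} \<subseteq> {x', y'}" for a a' c c' X x y x' y'
  proof -
    have w: "vwalk [sym_diff v {a, a'}, v, sym_diff v {c, c'}] ?G"
      using adj_v[OF that(1)] adj_v[OF that(2)] v by (simp add: vwalk_iff_successively verts)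
    have "vwalk [sym_diff v {a, a'}, sym_diff v X, sym_diff v {c, c'}] ?G" if
      "sym_diff v {a, a'} \<rightarrow>\<^bsub>?G\<^esub> sym_diff v X" "sym_diff v X \<rightarrow>\<^bsub>?G\<^esub> sym_diff v {c, c'}"
      using that by (auto simp add: vwalk_iff_successively verts basis_graph_arc_iff)
    \<comment> \<open>If \<open>X\<close> coincides with one of the two pairs, the end vertices are
      equal or adjacent; otherwise \<open>X\<close> is the fourth corner of a square.\<close>
    then show ?thesis
      using adj[OF that(1,3,6)] adj[OF that(3,2,7)] bypass_adjacent[OF w]
        bypass_square[OF wf_digraph_axioms w] lower[OF that(4,5)] by metis
  qed
  have L_common: "L {a, a'} {c, c'}"
    if "F {a, a'}" "F {c, c'}" "F X" "X \<subseteq> D" "X \<noteq> {}"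
      "sym_diff {a, a'} X \<subseteq> {x, y}" "sym_diff X {c, c'} \<subseteq> {x', y'}" for a a' c c' X x y x' y'
    unfolding L_def using common[OF that] common[OF that(2,1,3,4,5), of x' y' x y] that(6,7)
    by (auto simp: Un_commute)
  have L_trans: "L {a, a'} {c, c'}"
    if "L {a, a'} {e, e'}" "L {e, e'} {c, c'}" "F {a, a'}" "F {c, c'}" "F {e, e'}" "e \<in> D" "e' \<in> D"
    for a a' c c' e e'
  proof -
    have "d (sym_diff v {e, e'}) < d v" using lower that(6,7) by simp
    moreover have "vwalk [sym_diff v {a, a'}, v, sym_diff v {e, e'}, v, sym_diff v {c, c'}] ?G"
      "vwalk [sym_diff v {c, c'}, v, sym_diff v {e, e'}, v, sym_diff v {a, a'}] ?G"
      using adj_v[OF that(3)] adj_v[OF that(4)] adj_v[OF that(5)] v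
      by (simp_all add: vwalk_iff_successively verts)
    ultimately show ?thesis
      using that(1,2) bypass_trans unfolding L_def by metis
  qed
  \<comment> \<open>Pairs that share an element differ in at most two elements. Only the second pair
    has to lie in \<open>D\<close>, so the first may belong to a neighbour that is not closer to
    \<open>b\<close>.\<close>
  have L_meet: "L {a, a'} {c, c'}"
    if "{a, a'} \<inter> {c, c'} \<noteq> {}" "F {a, a'}" "F {c, c'}" "c \<in> D" "c' \<in> D" for a a' c c'
  proof -
    have "\<exists>x\<in>{a, a'}. \<exists>y\<in>{c, c'}. sym_diff {a, a'} {c, c'} \<subseteq> {x, y}" using that(1) by auto
    then obtain x y where "sym_diff {a, a'} {c, c'} \<subseteq> {x, y}" by blast
    then show ?thesis by (intro L_common[of _ _ _ _ "{c, c'}" x y c c']) (use that in auto)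
  qed
  have L_or_singleton: "L {a, a'} {c, c'} \<or> F {c}"
    if F: "F {a, a'}" "F {c, c'}" and D: "a \<in> D" "a' \<in> D" "c \<in> D" "c' \<in> D" for a a' c c'
  proof (cases "{a, a'} \<inter> {c, c'} = {}")
    case False
    then have "L {a, a'} {c, c'}" using L_meet F D by blast
    then show ?thesis ..
  next
    case disj: True
    have via: "L {a, a'} {c, c'}" if "F {c, x}" "x = a \<or> x = a'" for x
    proof -
      have "L {a, a'} {c, x}" using that F D by (intro L_meet) auto
      moreover have "L {c, x} {c, c'}" using that F D by (intro L_meet) auto
      ultimately show ?thesis using L_trans[of a a' c x c c'] F D that by auto
    qed
    \<comment> \<open>Exchanging \<open>c\<close> into \<open>{a, a'}\<close> yields a common
      neighbour inside \<open>D\<close>, a pair meeting both given pairs, a set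
      \<open>{a, a', c}\<close> treated by a second exchange, or \<open>{c}\<close> itself.\<close>
    have "c \<in> sym_diff {a, a'} {c, c'}" using disj by blast
    from exF[OF F this] obtain f where
      f: "f \<in> sym_diff {a, a'} {c, c'}" "F (sym_diff {a, a'} {c, f})" by blast
    then consider "f = c'" | "f = c" | "f = a" | "f = a'" by blast
    then show ?thesis
    proof cases
      case 1
      have "sym_diff {a, a'} {c, f} = {a, a', c, c'}" using 1 disj by auto
      then have "F {a, a', c, c'}" using f(2) by simp
      then have "L {a, a'} {c, c'}"
        by (rule L_common[OF F, of _ c c' a a']) (use D in auto)
      then show ?thesis ..
    next
      case 2
      have "sym_diff {a, a'} {c, f} = {a, a', c}" using 2 disj by auto
      then have F3: "F {a, a', c}" using f(2) by simp
      obtain g where "g \<in> {a, a', c}" "F {c, g}" using exF0[OF F3, of c] by blast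
      then have "g = a \<or> g = a' \<or> F {c}" by auto
      then show ?thesis using via[OF \<open>F {c, g}\<close>] by blast
    next
      case 3
      have "sym_diff {a, a'} {c, f} = (if a = a' then {c} else {c, a'})" using 3 disj by auto
      then show ?thesis using f(2) via by (auto split: if_splits)
    next
      case 4
      have "sym_diff {a, a'} {c, f} = (if a = a' then {c} else {c, a})" using 4 disj by auto
      then show ?thesis using f(2) via by (auto split: if_splits)
    qed
  qed
  have L_sym: "L S T \<Longrightarrow> L T S" for S T by (auto simp: L_def)
  have L_lower: "L {a, a'} {c, c'}"
    if F: "F {a, a'}" "F {c, c'}" and D: "a \<in> D" "a' \<in> D" "c \<in> D" "c' \<in> D" for a a' c c'
  proof (rule ccontr)
    \<comment> \<open>By symmetry a failure would make both \<open>{a}\<close> and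
      \<open>{c}\<close> lead to bases. These two are adjacent or equal, and the chain
      \<open>{a, a'}\<close>, \<open>{a}\<close>, \<open>{c}\<close>, \<open>{c, c'}\<close> links
      the pairs after all. Singletons are written \<open>{c, c}\<close> to fit the pair
      form.\<close>
    assume not: "\<not> L {a, a'} {c, c'}"
    have c: "F {c, c}" using L_or_singleton[OF F D] not by simp
    have a: "F {a, a}" using L_or_singleton[OF F(2,1) D(3,4,1,2)] not L_sym by auto
    have "L {a, a} {c, c}" by (rule L_common[OF a c a, of a a a c]) (use D in auto)
    moreover have "L {a, a'} {a, a}" using a F D by (intro L_meet) auto
    moreover have "L {c, c} {c, c'}" using c F D by (intro L_meet) auto
    ultimately have "L {a, a'} {c, c'}"
      using L_trans[of a a' a a c c] L_trans[of a a' c c c c'] a c F D by blast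
    with not show False ..
  qed
  have nbr: "\<exists>a a' f. x = sym_diff v {a, a'} \<and> F {a, a'} \<and> a \<in> D \<and> f \<in> D \<and> F {a, f}"
    if x: "v \<rightarrow>\<^bsub>?G\<^esub> x" "d x \<le> d v" for x
  proof -
    obtain p q where pq: "sym_diff v x = {p, q}" "x \<in> \<B>" using x(1) by (auto simp: basis_graph_arc_iff)
    then have xeq: "x = sym_diff v {p, q}" by blast
    \<comment> \<open>Flipping only elements outside \<open>D\<close> would enlarge the difference
      to \<open>b\<close>.\<close>
    have "p \<in> D \<or> q \<in> D"
    proof (rule ccontr)
      assume "\<not> (p \<in> D \<or> q \<in> D)"
      then have "sym_diff x b = insert p (insert q D)" "p \<notin> D"
        using xeq by (auto simp: D_def)
      then have "D \<subset> sym_diff x b" by auto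
      moreover have "finite (sym_diff x b)" using pq b fin by simp
      ultimately have "d v < d x" unfolding d_def D_def[symmetric] by (rule psubset_card_mono[rotated])
      with x(2) show False by simp
    qed
    then obtain a a' where a: "{p, q} = {a, a'}" "a \<in> D" by blast
    have "F {a, a'}" using pq(2) unfolding F_def a(1)[symmetric] xeq[symmetric] .
    \<comment> \<open>Exchange from \<open>v\<close> towards \<open>b\<close> at \<open>a\<close>
      supplies a neighbour of \<open>v\<close> inside \<open>D\<close> that shares \<open>a\<close>
      with \<open>x\<close>.\<close>
    moreover obtain f where "f \<in> D" "F {a, f}" using exF0[OF FD a(2)] by blast
    ultimately show ?thesis using a xeq by metis
  qed
  have arcs: "v \<rightarrow>\<^bsub>?G\<^esub> u" "v \<rightarrow>\<^bsub>?G\<^esub> w"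
    using walk by (auto simp: vwalk_iff_successively basis_graph_arc_iff Un_commute)
  obtain a a' f where a: "u = sym_diff v {a, a'}" "F {a, a'}" "a \<in> D" "f \<in> D" "F {a, f}"
    using nbr[OF arcs(1) le(1)] by blast
  obtain c c' g where c: "w = sym_diff v {c, c'}" "F {c, c'}" "c \<in> D" "g \<in> D" "F {c, g}"
    using nbr[OF arcs(2) le(2)] by blast
  \<comment> \<open>The chain runs from \<open>{a, a'}\<close> through \<open>{a, f}\<close> and
    \<open>{c, g}\<close> to \<open>{c, c'}\<close>; its middle link lies entirely inside
    \<open>D\<close>.\<close>
  have "L {a, a'} {a, f}" "L {c, c'} {c, g}" by (intro L_meet; use a c in auto)+
  then have "L {a, a'} {c, c'}"
    using L_trans[of a a' a f c g] L_trans[of a a' c g c c'] L_lower[of a f c g] L_sym a c by blast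
  then show ?thesis unfolding L_def a(1) c(1) by blast
qed

theorem theorem1p2:
  fixes n :: nat and \<B> :: "nat set set" and W W' :: "nat set vwalk"
  assumes "delta_matroid n \<B>"
    and "vwalk W (with_proj (basis_graph \<B>))"
    and "vwalk W' (with_proj (basis_graph \<B>))"
    and "hd W = hd W'"
    and "last W = last W'"
  shows "combinatorially_homotopic (with_proj (basis_graph \<B>)) W W'"
proof -
  note with_proj_simps [simp del]
  let ?G = "with_proj (basis_graph \<B>)"
  define b where "b = hd W"
  have fin: "finite B" if "B \<in> \<B>" for B
    by (rule finite_subset[of _ "{1..n}"]) (use assms(1) that in \<open>auto simp: delta_matroid_def\<close>)
  have exchange: "\<exists>f\<in>sym_diff B B'. sym_diff B {e, f} \<in> \<B>"
    if "B \<in> \<B>" "B' \<in> \<B>" "e \<in> sym_diff B B'" for B B' e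
    using assms(1) that unfolding delta_matroid_def by blast
  have verts: "verts ?G = \<B>" by (simp add: basis_graph_def with_proj_simps)
  have b: "b \<in> \<B>" using assms(2) verts by (auto simp: vwalk_def b_def)
  have contract: "combinatorially_homotopic ?G V [b]"
    if "vwalk V ?G" "hd V = b" "last V = b" for V
  proof (rule closed_walk_contractible[where d = "\<lambda>x. card (sym_diff x b)", OF _ _ _ that])
    show "bypass ?G (\<lambda>x. card (sym_diff x b)) v u w"
      if "vwalk [u, v, w] ?G" "card (sym_diff u b) \<le> card (sym_diff v b)"
        "card (sym_diff w b) \<le> card (sym_diff v b)" for u v w
      using bypass_basis_graph[OF exchange fin b that] .
    show "card (sym_diff v b) = 0 \<longleftrightarrow> v = b" if "v \<in> verts ?G" for v
    proof -
      \<comment> \<open>An infinite set also has \<open>card\<close> 0, so finiteness is what makes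
        the height vanish only at \<open>b\<close>.\<close>
      have "finite (sym_diff v b)" using that fin b verts by simp
      then show ?thesis by auto
    qed
    show "\<not> v \<rightarrow>\<^bsub>?G\<^esub> v" for v
      unfolding basis_graph_arc_iff by simp
  qed
  show ?thesis
    by (rule homotopic_if_closed_walks_contractible[OF contract _ assms(2,3)])
      (use assms(4,5) in \<open>auto simp: b_def basis_graph_arc_iff Un_commute\<close>)
qed

end
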